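(* Let $m>0$ and let $A=(A_1,A_2,A_3)$, where each $A_j:\mathbb{R}^3\to\mathbb{R}$ ($j=1,2,3$) is a measurable function satisfying $|A_j(x)|\le C\langle x\rangle^{-\rho}$ with some $\rho>3/2$ and a positive constant $C$. Suppose that $f$ belongs to $[L^2_{\rm loc}(\mathbb{R}^3)]^4$ and satisfies either of the equations $H_Af=\pm mf$ in the distributional sense. In addition, suppose that $f$ has the asymptotic expansion $$f(x)=C_1|x|^{-1}+C_2|x|^{-2}+o(|x|^{-2})$$ as $|x|\to\infty$, where $C_1$ and $C_2$ are constant vectors in $\mathbb{C}^4$. Then $C_1=0$.
   Context: $\langle x\rangle=\sqrt{1+|x|^2}$, $D=\frac1i\nabla_x$; $\sigma_1=\begin{pmatrix}0&1\\1&0\end{pmatrix}$, $\sigma_2=\begin{pmatrix}0&-i\\i&0\end{pmatrix}$, $\sigma_3=\begin{pmatrix}1&0\\0&-1\end{pmatrix}$ are the Pauli matrices; $\alpha_j=\begin{pmatrix}\mathbf 0&\sigma_j\\\sigma_j&\mathbf 0\end{pmatrix}$ $(j=1,2,3)$ and $\beta=\begin{pmatrix}I_2&\mathbf 0\\\mathbf 0&-I_2\end{pmatrix}$ are the Dirac matrices. Here $H_A=\alpha\cdot(D-A(x))+m\beta$ denotes the formal differential operator acting on $\mathbb{C}^4$-valued functions on $\mathbb{R}^3$ (in the sense of distributions). *)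

theory Defs
  imports "HOL-Analysis.Analysis" "HOL-Library.Landau_Symbols"
begin

definition japanese_bracket :: "real^3 \<Rightarrow> real" where
  "japanese_bracket x = sqrt (1 + (norm x)\<^sup>2)"

definition pauli :: "3 \<Rightarrow> complex^2^2" where
  "pauli j =
    (vector
      [vector [vector [0, 1], vector [1, 0]],
       vector [vector [0, - \<i>], vector [\<i>, 0]],
       vector [vector [1, 0], vector [0, - 1]]] :: complex^2^2^3) $ j"

text \<open>The matrix with block rows \<open>(P Q)\<close> and \<open>(R S)\<close>.\<close>

definition block_matrix ::
    "complex^2^2 \<Rightarrow> complex^2^2 \<Rightarrow> complex^2^2 \<Rightarrow> complex^2^2 \<Rightarrow> complex^4^4" where
  "block_matrix P Q R S = vector
    [vector [P$1$1, P$1$2, Q$1$1, Q$1$2],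
     vector [P$2$1, P$2$2, Q$2$1, Q$2$2],
     vector [R$1$1, R$1$2, S$1$1, S$1$2],
     vector [R$2$1, R$2$2, S$2$1, S$2$2]]"

definition dirac_alpha :: "3 \<Rightarrow> complex^4^4" where
  "dirac_alpha j = block_matrix 0 (pauli j) (pauli j) 0"

definition dirac_beta :: "complex^4^4" where
  "dirac_beta = block_matrix (mat 1) 0 0 (- mat 1)"

definition L2_loc :: "(real^3 \<Rightarrow> complex^4) set" where
  "L2_loc = {f. f \<in> borel_measurable lebesgue \<and>
     (\<forall>K. compact K \<longrightarrow> set_integrable lebesgue K (\<lambda>x. (norm (f x))\<^sup>2))}"

definition partial_deriv :: "3 \<Rightarrow> (real^3 \<Rightarrow> complex) \<Rightarrow> real^3 \<Rightarrow> complex" where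
  "partial_deriv j \<phi> x = frechet_derivative \<phi> (at x) (axis j 1)"

text \<open>
  The space of infinitely differentiable functions with compact support. Requiring every iterated
  partial derivative to be (totally) differentiable is the same as requiring all of them to exist
  and be continuous.
\<close>

definition test_functions :: "(real^3 \<Rightarrow> complex) set" where
  "test_functions = {\<phi>.
     (\<forall>js x. foldr partial_deriv js \<phi> differentiable at x) \<and>
     compact (closure {x. \<phi> x \<noteq> 0})}"

text \<open>
  A \<open>\<complex>\<^sup>4\<close>-valued distribution is represented by its (bilinear, not sesquilinear) action on scalar
  test functions; only the values on \<open>test_functions\<close> are meaningful.
\<close>

type_synonym distribution = "(real^3 \<Rightarrow> complex) \<Rightarrow> complex^4"

definition distribution_of :: "(real^3 \<Rightarrow> complex^4) \<Rightarrow> distribution" where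
  "distribution_of f \<phi> = (LINT x|lebesgue. \<phi> x *s f x)"

text \<open>\<open>D\<^sub>j = (1/i) \<partial>\<^sub>j\<close>, where \<open>(\<partial>\<^sub>j T)(\<phi>) = - T(\<partial>\<^sub>j \<phi>)\<close>.\<close>

definition distribution_D :: "3 \<Rightarrow> distribution \<Rightarrow> distribution" where
  "distribution_D j T \<phi> = (1 / \<i>) *s (- T (partial_deriv j \<phi>))"

text \<open>The distribution \<open>H\<^sub>A f = \<alpha> \<cdot> (D - A) f + m \<beta> f\<close>.\<close>

definition magnetic_dirac ::
    "real \<Rightarrow> (real^3 \<Rightarrow> real^3) \<Rightarrow> (real^3 \<Rightarrow> complex^4) \<Rightarrow> distribution" where
  "magnetic_dirac m A f \<phi> =
     (\<Sum>j\<in>UNIV. dirac_alpha j *v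
        (distribution_D j (distribution_of f) \<phi>
          - distribution_of (\<lambda>x. (A x $ j) *\<^sub>R f x) \<phi>))
     + complex_of_real m *s (dirac_beta *v distribution_of f \<phi>)"

definition dirac_equation ::
    "real \<Rightarrow> (real^3 \<Rightarrow> real^3) \<Rightarrow> real \<Rightarrow> (real^3 \<Rightarrow> complex^4) \<Rightarrow> bool" where
  "dirac_equation m A lam f \<longleftrightarrow>
     (\<forall>\<phi>\<in>test_functions.
        magnetic_dirac m A f \<phi> = complex_of_real lam *s distribution_of f \<phi>)"

end

theory Submission
  imports Defs "HOL-Computational_Algebra.Polynomial"
begin

text \<open>
  The expansion is probed with an odd test function that vanishes near the origin and is stretched by
  a factor \<open>R \<rightarrow> \<infinity>\<close>. Put \<open>\<psi>(x) = \<phi>(x/R)\<close>, test the Dirac equation with \<open>\<psi>\<close>, substitute \<open>x = R y\<close> and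
  divide by \<open>R\<close> (\<open>dirac_equation_test_scaled\<close>). Three kinds of integrals remain.

  \<^item> The derivative terms are \<open>\<integral> \<partial>\<^sub>j\<phi>(y) R f(R y) dy\<close>. Since \<open>R f(R y) \<rightarrow> C\<^sub>1 / |y|\<close>, they tend to
    \<open>w\<^sub>j C\<^sub>1\<close> with \<open>w\<^sub>j = \<integral> \<partial>\<^sub>j\<phi>(y) / |y| dy\<close>.
  \<^item> The potential contributes \<open>\<integral> \<phi>(y) R A\<^sub>j(R y) R f(R y) dy\<close>, which is of order \<open>R\<close> to the power
    \<open>1 - \<rho>\<close> and tends to zero.
  \<^item> The mass and the energy both multiply \<open>\<integral> \<phi>(y) R\<^sup>2 f(R y) dy\<close>. Taken by itself, the \<open>C\<^sub>1\<close> part of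
    the integrand grows like \<open>R\<close>, but it and the \<open>C\<^sub>2\<close> part are even functions of \<open>y\<close>, so they integrate
    to zero against the odd \<open>\<phi>\<close>, and the remainder of the expansion tends to zero.

  In the limit \<open>(\<alpha> \<cdot> w) C\<^sub>1 = 0\<close> (\<open>odd_test_function_limit\<close>). The Clifford relations give
  \<open>(\<alpha> \<cdot> w)\<^sup>2 = |w|\<^sup>2\<close>, so \<open>C\<^sub>1 = 0\<close> as soon as \<open>w\<close> is real and nonzero (\<open>dirac_alpha_kernel_trivial\<close>).
  If \<open>\<phi>\<close> is real and \<open>\<phi>(y) y\<^sub>3\<close> is nonnegative and not identically zero, integration by parts gives
  \<open>w\<^sub>3 = \<integral> \<phi>(y) y\<^sub>3 / |y|\<^sup>3 dy > 0\<close> (\<open>odd_test_weight_nonzero\<close>). A product of an even bump in each of the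
  first two coordinates and an odd one in the third has these properties.
\<close>

section \<open>Smooth functions with compact support\<close>

text \<open>
  The factor \<open>exp (- 1/t)\<close> beats every power of \<open>1/t\<close>, so these functions are flat at the origin. The
  polynomial in \<open>1/t\<close> is carried along because differentiation produces such factors.
\<close>

definition flat_exp :: "real poly \<Rightarrow> real \<Rightarrow> real" where
  "flat_exp p t = (if t > 0 then poly p (1 / t) * exp (- (1 / t)) else 0)"

lemma poly_mult_exp_minus_tendsto_0:
  fixes p :: "real poly"
  shows "((\<lambda>s. poly p s * exp (- s)) \<longlongrightarrow> 0) at_top"
proof -
  have "((\<lambda>s. \<Sum>i\<le>degree p. coeff p i * (s ^ i / exp s)) \<longlongrightarrow> (\<Sum>i\<le>degree p. coeff p i * 0)) at_top"
    by (intro tendsto_sum tendsto_mult tendsto_const tendsto_power_div_exp_0)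
  then show ?thesis
    by (simp add: poly_altdef sum_distrib_right exp_minus divide_inverse mult.assoc)
qed

lemma flat_exp_tendsto_0: "(flat_exp p \<longlongrightarrow> 0) (at 0)"
proof -
  have "((\<lambda>t. poly p (inverse t) * exp (- inverse t)) \<longlongrightarrow> 0) (at_right 0)"
    by (rule filterlim_compose[OF poly_mult_exp_minus_tendsto_0 filterlim_inverse_at_top_right])
  then have "(flat_exp p \<longlongrightarrow> 0) (at_right 0)"
    by (rule Lim_transform_eventually)
      (auto simp: flat_exp_def eventually_at_filter inverse_eq_divide)
  moreover have "(flat_exp p \<longlongrightarrow> 0) (at_left 0)"
    by (rule Lim_transform_eventually[OF tendsto_const])
      (auto simp: flat_exp_def eventually_at_filter)
  ultimately show ?thesis
    by (simp add: filterlim_split_at)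
qed

text \<open>
  For \<open>t > 0\<close> this is the product rule with \<open>(1/t)' = - 1/t\<^sup>2\<close>. At the origin the difference quotient is
  again a flat function, the one with polynomial \<open>s p(s)\<close>, and tends to \<open>0\<close>.
\<close>

lemma DERIV_flat_exp:
  "(flat_exp p has_real_derivative flat_exp ([:0, 0, 1:] * (p - pderiv p)) t) (at t)"
proof -
  consider "t > 0" | "t < 0" | "t = 0" by linarith
  then show ?thesis
  proof cases
    case 1
    have "((\<lambda>t. poly p (1 / t) * exp (- (1 / t))) has_real_derivative
        flat_exp ([:0, 0, 1:] * (p - pderiv p)) t) (at t)"
      using 1 by (auto intro!: derivative_eq_intros poly_DERIV[THEN DERIV_chain2]
          simp: flat_exp_def power2_eq_square field_simps)
    then show ?thesis
      by (rule DERIV_cong_ev[OF refl _ refl, THEN iffD1, rotated])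
        (use 1 in \<open>auto simp: flat_exp_def eventually_nhds intro!: exI[of _ "{0<..}"]\<close>)
  next
    case 2
    have "((\<lambda>t. 0) has_real_derivative flat_exp ([:0, 0, 1:] * (p - pderiv p)) t) (at t)"
      using 2 by (simp add: flat_exp_def)
    then show ?thesis
      by (rule DERIV_cong_ev[OF refl _ refl, THEN iffD1, rotated])
        (use 2 in \<open>auto simp: flat_exp_def eventually_nhds intro!: exI[of _ "{..<0}"]\<close>)
  next
    case 3
    have "flat_exp (pCons 0 p) t = (flat_exp p t - flat_exp p 0) / (t - 0)" for t
      by (simp add: flat_exp_def)
    then have "((\<lambda>t. (flat_exp p t - flat_exp p 0) / (t - 0)) \<longlongrightarrow> 0) (at 0)"
      using flat_exp_tendsto_0[of "pCons 0 p"] by presburger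
    then show ?thesis
      using 3 by (simp add: has_field_derivative_iff flat_exp_def)
  qed
qed

text \<open>
  An algebra that contains bump functions and in which every function has a derivative. It stands in for
  the smooth functions: smoothness of its members follows by one induction over the generators, without
  a Leibniz formula for higher derivatives.
\<close>

inductive_set flat_algebra :: "(real \<Rightarrow> real) set" where
  flat: "(\<lambda>t. flat_exp p (a * t + b)) \<in> flat_algebra"
| const: "(\<lambda>t. c) \<in> flat_algebra"
| add: "f \<in> flat_algebra \<Longrightarrow> g \<in> flat_algebra \<Longrightarrow> (\<lambda>t. f t + g t) \<in> flat_algebra"
| mult: "f \<in> flat_algebra \<Longrightarrow> g \<in> flat_algebra \<Longrightarrow> (\<lambda>t. f t * g t) \<in> flat_algebra"

lemma flat_algebra_DERIV:
  assumes "f \<in> flat_algebra"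
  shows "\<exists>f'\<in>flat_algebra. \<forall>t. (f has_real_derivative f' t) (at t)"
  using assms
proof induction
  case (flat p a b)
  let ?q = "[:0, 0, 1:] * (p - pderiv p)"
  have "((\<lambda>t. a * t + b) has_real_derivative a) (at t)" for t
    by (auto intro!: derivative_eq_intros)
  then have "((\<lambda>t. flat_exp p (a * t + b)) has_real_derivative flat_exp ?q (a * t + b) * a) (at t)" for t
    by (rule DERIV_chain2[OF DERIV_flat_exp])
  moreover have "(\<lambda>t. flat_exp ?q (a * t + b) * a) \<in> flat_algebra"
    by (intro flat_algebra.mult flat_algebra.const flat_algebra.flat)
  ultimately show ?case by (intro bexI[of _ "\<lambda>t. flat_exp ?q (a * t + b) * a"] allI)
next
  case (const c)
  then show ?case
    by (intro bexI[of _ "\<lambda>t. 0"] flat_algebra.const) auto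
next
  case (add f g)
  then obtain f' g' where "f' \<in> flat_algebra" "g' \<in> flat_algebra"
    "\<And>t. (f has_real_derivative f' t) (at t)" "\<And>t. (g has_real_derivative g' t) (at t)" by blast
  then show ?case
    by (intro bexI[of _ "\<lambda>t. f' t + g' t"] flat_algebra.add) (auto intro: DERIV_add)
next
  case (mult f g)
  then obtain f' g' where "f' \<in> flat_algebra" "g' \<in> flat_algebra"
    "\<And>t. (f has_real_derivative f' t) (at t)" "\<And>t. (g has_real_derivative g' t) (at t)" by blast
  then show ?case
    using mult.hyps
    by (intro bexI[of _ "\<lambda>t. f' t * g t + f t * g' t"] flat_algebra.add flat_algebra.mult allI)
       (auto intro!: derivative_eq_intros)
qed

lemma flat_algebra_shift:
  assumes "f \<in> flat_algebra"
  shows "(\<lambda>t. f (t + c)) \<in> flat_algebra"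
  using assms
proof induction
  case (flat p a b)
  show ?case
    using flat_algebra.flat[of p a "a * c + b"] by (simp add: algebra_simps)
qed (auto intro: flat_algebra.intros)

definition bump :: "real \<Rightarrow> real" where
  "bump t = flat_exp 1 (1 + t) * flat_exp 1 (1 - t)"

text \<open>
  The shift by \<open>2\<close> makes the function vanish on \<open>[-1, 1]\<close>. As a factor in the third coordinate it thus keeps
  the test function away from the origin, where \<open>1 / |y|\<close> is singular.
\<close>

definition odd_bump :: "real \<Rightarrow> real" where
  "odd_bump t = bump (t - 2) - bump (t + 2)"

lemma bump_in_flat_algebra: "bump \<in> flat_algebra"
  using flat_algebra.mult[OF flat_algebra.flat[of 1 1 1] flat_algebra.flat[of 1 "-1" 1]]
  by (simp add: bump_def[abs_def] add.commute)

lemma odd_bump_in_flat_algebra: "odd_bump \<in> flat_algebra"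
  using flat_algebra.add[OF flat_algebra_shift[OF bump_in_flat_algebra, of "-2"]
      flat_algebra.mult[OF flat_algebra.const[of "-1"] flat_algebra_shift[OF bump_in_flat_algebra, of 2]]]
  by (simp add: odd_bump_def[abs_def])

lemma bump_pos_iff: "bump t > 0 \<longleftrightarrow> \<bar>t\<bar> < 1"
  by (auto simp: bump_def flat_exp_def zero_less_mult_iff)

lemma bump_nonneg: "bump t \<ge> 0"
  by (auto simp: bump_def flat_exp_def)

lemma bump_eq_0: "\<bar>t\<bar> \<ge> 1 \<Longrightarrow> bump t = 0"
  using bump_pos_iff[of t] bump_nonneg[of t] by linarith

lemma bump_even: "bump (- t) = bump t"
  by (simp add: bump_def)

lemma odd_bump_odd: "odd_bump (- t) = - odd_bump t"
  using bump_even[of "t - 2"] bump_even[of "t + 2"]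
  by (simp add: odd_bump_def algebra_simps)

lemma odd_bump_eq_0: "\<bar>t\<bar> \<le> 1 \<or> \<bar>t\<bar> \<ge> 3 \<Longrightarrow> odd_bump t = 0"
  by (auto simp: odd_bump_def bump_eq_0)

lemma odd_bump_times_nonneg: "odd_bump t * t \<ge> 0"
  using bump_nonneg[of "t - 2"] bump_nonneg[of "t + 2"]
  by (cases "t \<ge> 0") (auto simp: odd_bump_def bump_eq_0 mult_nonneg_nonpos)

definition tensor3 :: "(real \<Rightarrow> real) \<Rightarrow> (real \<Rightarrow> real) \<Rightarrow> (real \<Rightarrow> real) \<Rightarrow> real^3 \<Rightarrow> real" where
  "tensor3 p q r x = p (x $ 1) * q (x $ 2) * r (x $ 3)"

lemma has_derivative_tensor3:
  assumes "\<And>t. (p has_real_derivative p' t) (at t)"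
    and "\<And>t. (q has_real_derivative q' t) (at t)"
    and "\<And>t. (r has_real_derivative r' t) (at t)"
  shows "(tensor3 p q r has_derivative
    (\<lambda>v. tensor3 p' q r x * v $ 1 + tensor3 p q' r x * v $ 2 + tensor3 p q r' x * v $ 3)) (at x)"
proof -
  have D: "((\<lambda>x. g (x $ k)) has_derivative (\<lambda>v. g' (x $ k) * v $ k)) (at x)"
    if "\<And>t. (g has_real_derivative g' t) (at t)" for g g' and k :: 3 and x :: "real^3"
    using has_derivative_compose[OF bounded_linear_imp_has_derivative[OF bounded_linear_vec_nth[of k]],
        OF that[THEN has_field_derivative_imp_has_derivative]] .
  show ?thesis
    unfolding tensor3_def[abs_def]
    by (rule has_derivative_eq_rhs[OF has_derivative_mult[OF has_derivative_mult[OF D D] D]])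
      (auto intro: assms simp: algebra_simps)
qed

lemma partial_deriv_of_real:
  assumes "(F has_derivative F') (at x)"
  shows "(\<lambda>x. complex_of_real (F x)) differentiable at x"
    and "partial_deriv j (\<lambda>x. complex_of_real (F x)) x = complex_of_real (F' (axis j 1))"
proof -
  have "((\<lambda>x. complex_of_real (F x)) has_derivative (\<lambda>v. complex_of_real (F' v))) (at x)"
    using assms by (rule has_derivative_of_real)
  then show "(\<lambda>x. complex_of_real (F x)) differentiable at x"
    and "partial_deriv j (\<lambda>x. complex_of_real (F x)) x = complex_of_real (F' (axis j 1))"
    by (auto simp: partial_deriv_def frechet_derivative_at[symmetric] differentiable_def)
qed

text \<open>
  A partial derivative acts on one factor only. Hence products of members of the algebra are closed under
  partial derivatives, which makes them infinitely differentiable.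
\<close>

lemma partial_deriv_tensor3:
  assumes "p \<in> flat_algebra" "q \<in> flat_algebra" "r \<in> flat_algebra"
  shows "\<exists>p'\<in>flat_algebra. \<exists>q'\<in>flat_algebra. \<exists>r'\<in>flat_algebra.
    partial_deriv j (\<lambda>x. complex_of_real (tensor3 p q r x)) = (\<lambda>x. complex_of_real (tensor3 p' q' r' x))"
proof -
  obtain p' where p': "p' \<in> flat_algebra" "\<And>t. (p has_real_derivative p' t) (at t)"
    using flat_algebra_DERIV assms(1) by blast
  obtain q' where q': "q' \<in> flat_algebra" "\<And>t. (q has_real_derivative q' t) (at t)"
    using flat_algebra_DERIV assms(2) by blast
  obtain r' where r': "r' \<in> flat_algebra" "\<And>t. (r has_real_derivative r' t) (at t)"
    using flat_algebra_DERIV assms(3) by blast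
  note D = partial_deriv_of_real(2)[OF has_derivative_tensor3[OF p'(2) q'(2) r'(2)]]
  consider "j = 1" | "j = 2" | "j = 3" using exhaust_3 by blast
  then show ?thesis
  proof cases
    case 1
    then show ?thesis using p'(1) assms
      by (intro bexI[of _ p'] bexI[of _ q] bexI[of _ r]) (auto simp: D axis_def fun_eq_iff)
  next
    case 2
    then show ?thesis using q'(1) assms
      by (intro bexI[of _ p] bexI[of _ q'] bexI[of _ r]) (auto simp: D axis_def fun_eq_iff)
  next
    case 3
    then show ?thesis using r'(1) assms
      by (intro bexI[of _ p] bexI[of _ q] bexI[of _ r']) (auto simp: D axis_def fun_eq_iff)
  qed
qed

lemma tensor3_test_function:
  assumes "p \<in> flat_algebra" "q \<in> flat_algebra" "r \<in> flat_algebra"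
    and "bounded {x. tensor3 p q r x \<noteq> 0}"
  shows "(\<lambda>x. complex_of_real (tensor3 p q r x)) \<in> test_functions"
proof -
  have "\<exists>p'\<in>flat_algebra. \<exists>q'\<in>flat_algebra. \<exists>r'\<in>flat_algebra.
    foldr partial_deriv js (\<lambda>x. complex_of_real (tensor3 p q r x))
      = (\<lambda>x. complex_of_real (tensor3 p' q' r' x))" for js
  proof (induction js)
    case Nil
    then show ?case using assms by auto
  next
    case (Cons j js)
    then show ?case using partial_deriv_tensor3 by fastforce
  qed
  moreover have "(\<lambda>x. complex_of_real (tensor3 p q r x)) differentiable at x"
    if "p \<in> flat_algebra" "q \<in> flat_algebra" "r \<in> flat_algebra" for p q r x
    using that[THEN flat_algebra_DERIV] partial_deriv_of_real(1)[OF has_derivative_tensor3] by blast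
  ultimately have "foldr partial_deriv js (\<lambda>x. complex_of_real (tensor3 p q r x)) differentiable at x" for js x
    by metis
  then show ?thesis
    using assms(4) by (simp add: test_functions_def compact_closure)
qed

section \<open>Integrals over Euclidean space\<close>

lemma lebesgue_integral_scaleR:
  fixes g :: "'a::euclidean_space \<Rightarrow> 'b::{banach, second_countable_topology}"
  assumes g: "g \<in> borel_measurable lebesgue" and c: "c \<noteq> 0"
  shows "(LINT x|lebesgue. g x) = \<bar>c\<bar> ^ DIM('a) *\<^sub>R (LINT x|lebesgue. g (c *\<^sub>R x))"
proof -
  let ?D = "distr lebesgue lebesgue ((*\<^sub>R) c) :: 'a measure"
  have "(\<Sum>j\<in>Basis. (c * (x \<bullet> j)) *\<^sub>R j) = c *\<^sub>R x" for x :: 'a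
    unfolding scaleR_scaleR[symmetric] scaleR_sum_right[symmetric] euclidean_representation ..
  then have L: "lebesgue = density ?D (\<lambda>_. ennreal (\<bar>c\<bar> ^ DIM('a)))"
    using lebesgue_affine_euclidean[of "\<lambda>_::'a. c" 0] c by (simp add: ennreal_power)
  have "(LINT x|lebesgue. g x) = (LINT x|density ?D (\<lambda>_. ennreal (\<bar>c\<bar> ^ DIM('a))). g x)"
    using L by simp
  also have "\<dots> = (LINT x|?D. \<bar>c\<bar> ^ DIM('a) *\<^sub>R g x)"
    using g by (intro integral_density) auto
  also have "\<dots> = (LINT x|lebesgue. \<bar>c\<bar> ^ DIM('a) *\<^sub>R g (c *\<^sub>R x))"
    using g by (intro integral_distr) auto
  finally show ?thesis by simp
qed

lemma lebesgue_integral_odd: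
  fixes g :: "'a::euclidean_space \<Rightarrow> 'b::{banach, second_countable_topology}"
  assumes "g \<in> borel_measurable lebesgue" and "\<And>x. g (- x) = - g x"
  shows "(LINT x|lebesgue. g x) = 0"
proof -
  have "(LINT x|lebesgue. g x) = - (LINT x|lebesgue. g x)"
    using lebesgue_integral_scaleR[OF assms(1), of "-1"] assms(2) by simp
  then have "2 *\<^sub>R (LINT x|lebesgue. g x) = 0"
    by (simp add: scaleR_2 eq_neg_iff_add_eq_0)
  then show ?thesis by simp
qed

lemma integrable_bounded_support:
  fixes g :: "'a::euclidean_space \<Rightarrow> 'b::{banach, second_countable_topology}"
  assumes "g \<in> borel_measurable lebesgue" and "\<And>x. norm (g x) \<le> M" and "\<And>x. norm x > B \<Longrightarrow> g x = 0"
  shows "integrable lebesgue g"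
proof (rule integrableI_bounded_set[where A = "cball 0 B" and B = M])
  show "emeasure lebesgue (cball (0::'a) B) < \<infinity>"
    using emeasure_bounded_finite[of "cball (0::'a) B"] by auto
qed (use assms in auto)

lemma lebesgue_integral_translate:
  fixes g :: "'a::euclidean_space \<Rightarrow> 'b::{banach, second_countable_topology}"
  assumes "g \<in> borel_measurable borel"
  shows "(LINT x|lebesgue. g (x + c)) = (LINT x|lebesgue. g x)"
proof -
  have "(LINT x|lborel. g x) = (LINT x|distr lborel borel ((+) c). g x)"
    by (simp add: lborel_distr_plus)
  also have "\<dots> = (LINT x|lborel. g (x + c))"
    using assms by (simp add: integral_distr add.commute)
  finally show ?thesis
    using assms by (simp add: integral_completion)
qed

text \<open>
  By translation invariance the difference quotients of \<open>F\<close> in direction \<open>e\<close> integrate to zero. They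
  converge to the directional derivative, and the mean value theorem bounds them uniformly, so
  the limit integrates to zero as well.
\<close>

lemma integral_directional_derivative_eq_0:
  fixes F :: "'a::euclidean_space \<Rightarrow> real"
  assumes deriv: "\<And>x. (F has_derivative F' x) (at x)"
    and bound: "\<And>x. \<bar>F' x e\<bar> \<le> M"
    and supp: "\<And>x. norm x > B \<Longrightarrow> F x = 0"
  shows "(LINT x|lebesgue. F' x e) = 0"
proof -
  define h :: "nat \<Rightarrow> real" where "h n = inverse (real (Suc n))" for n
  define D where "D n x = (F (x + h n *\<^sub>R e) - F x) / h n" for n x
  have h: "h n > 0" "h n \<le> 1" for n
    by (auto simp: h_def inverse_le_1_iff)
  have hlim: "h \<longlonglongrightarrow> 0"
    unfolding h_def by (rule LIMSEQ_inverse_real_of_nat)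
  have deriv': "((\<lambda>t. F (x + t *\<^sub>R e)) has_real_derivative F' (x + t *\<^sub>R e) e) (at t)" for x t
  proof -
    have "((\<lambda>t. x + t *\<^sub>R e) has_derivative (\<lambda>s. s *\<^sub>R e)) (at t)"
      by (auto intro!: derivative_eq_intros)
    from has_derivative_compose[OF this deriv]
    have "((\<lambda>t. F (x + t *\<^sub>R e)) has_derivative (\<lambda>s. F' (x + t *\<^sub>R e) (s *\<^sub>R e))) (at t)" .
    moreover have "F' (x + t *\<^sub>R e) (s *\<^sub>R e) = F' (x + t *\<^sub>R e) e * s" for s
      using has_derivative_linear[OF deriv] by (simp add: linear_scale)
    ultimately show ?thesis
      by (simp add: has_field_derivative_def)
  qed
  have Dlim: "(\<lambda>n. D n x) \<longlonglongrightarrow> F' x e" for x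
  proof -
    have "((\<lambda>t. (F (x + t *\<^sub>R e) - F x) / t) \<longlongrightarrow> F' x e) (at 0)"
      using deriv'[of x 0] by (simp add: has_field_derivative_iff)
    moreover have "filterlim h (at 0) sequentially"
      using hlim h(1) by (auto simp: filterlim_at less_imp_neq[symmetric] intro!: always_eventually)
    ultimately show ?thesis
      unfolding D_def by (rule filterlim_compose)
  qed
  have Dbound: "\<bar>D n x\<bar> \<le> M" for n x
  proof -
    obtain z where "F (x + h n *\<^sub>R e) - F (x + 0 *\<^sub>R e) = (h n - 0) * F' (x + z *\<^sub>R e) e"
      using MVT2[OF h(1)[of n], of "\<lambda>t. F (x + t *\<^sub>R e)" "\<lambda>t. F' (x + t *\<^sub>R e) e"] deriv' by blast
    then show ?thesis
      using bound[of "x + z *\<^sub>R e"] h(1)[of n] by (simp add: D_def)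
  qed
  have shifted_supp: "F (x + c) = 0" if "norm x > B + norm c" for x c
  proof (rule supp)
    have "norm x \<le> norm (x + c) + norm c"
      by (metis add_diff_cancel_right' norm_triangle_ineq4)
    then show "norm (x + c) > B" using that by linarith
  qed
  have Dsupp: "D n x = 0" if "norm x > B + norm e" for n x
  proof -
    have "norm (h n *\<^sub>R e) \<le> norm e"
      using h[of n] by (simp add: mult_left_le_one_le)
    then show ?thesis
      using that shifted_supp[of "h n *\<^sub>R e" x] supp[of x] norm_ge_zero[of e] by (simp add: D_def)
  qed
  have cont: "continuous_on UNIV F"
    using deriv by (auto intro!: continuous_at_imp_continuous_on has_derivative_continuous)
  then have F[measurable]: "F \<in> borel_measurable borel"
    by (rule borel_measurable_continuous_onI)
  have Dmeas: "D n \<in> borel_measurable lebesgue" for n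
    by (rule measurable_completion) (unfold D_def, measurable)
  have "bounded (F ` cball 0 B)"
    using cont by (intro compact_imp_bounded compact_continuous_image) (auto intro: continuous_on_subset)
  then obtain L where "L > 0" "\<And>x. norm x \<le> B \<Longrightarrow> \<bar>F x\<bar> \<le> L"
    by (auto simp: bounded_pos)
  then have L: "\<bar>F x\<bar> \<le> L" for x
    using supp[of x] by (cases "norm x \<le> B") auto
  have Fint: "integrable lebesgue (\<lambda>x. F (x + c))" for c
    by (rule integrable_bounded_support[where M = L and B = "B + norm c"])
      (use L shifted_supp in \<open>auto intro!: measurable_completion\<close>)
  have D0: "(LINT x|lebesgue. D n x) = 0" for n
    using Fint Fint[of 0] by (simp add: D_def lebesgue_integral_translate)
  have "(\<lambda>n. LINT x|lebesgue. D n x) \<longlonglongrightarrow> (LINT x|lebesgue. F' x e)"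
  proof (rule integral_dominated_convergence[where w = "\<lambda>x. indicator (cball 0 (B + norm e)) x * \<bar>M\<bar>"])
    show "integrable lebesgue (\<lambda>x::'a. indicator (cball 0 (B + norm e)) x * \<bar>M\<bar>)"
      by (rule integrable_bounded_support[where M = "\<bar>M\<bar>" and B = "B + norm e"])
        (auto simp: indicator_def intro!: measurable_completion)
    show "AE x in lebesgue. norm (D n x) \<le> indicator (cball 0 (B + norm e)) x * \<bar>M\<bar>" for n
    proof (rule AE_I2)
      fix x
      show "norm (D n x) \<le> indicator (cball 0 (B + norm e)) x * \<bar>M\<bar>"
        using Dbound[of n x] Dsupp[of x n] by (cases "norm x > B + norm e") auto
    qed
    show "(\<lambda>x. F' x e) \<in> borel_measurable lebesgue"
      by (rule borel_measurable_LIMSEQ_real[OF Dlim Dmeas])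
  qed (use Dmeas Dlim in auto)
  then show ?thesis
    unfolding D0 by (simp add: LIMSEQ_const_iff)
qed

lemma norm_vector_scalar_mult:
  fixes v :: "complex^'n"
  shows "norm (c *s v) = norm c * norm v"
  by (simp add: norm_vec_def norm_mult L2_set_right_distrib)

lemma vector_scalar_mult_scaleR:
  fixes v :: "complex^'n"
  shows "c *s (r *\<^sub>R v) = r *\<^sub>R (c *s v)" and "(r *\<^sub>R c) *s v = r *\<^sub>R (c *s v)"
  by (simp_all add: vec_eq_iff algebra_simps)

lemma bounded_linear_vector_scalar_mult_left:
  "bounded_linear (\<lambda>c. c *s (v :: complex^'n))"
  by (rule bounded_linear_intro[where K = "norm v"])
    (simp_all add: vec_eq_iff algebra_simps norm_vector_scalar_mult)

lemma bounded_linear_vector_scalar_mult_right: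
  "bounded_linear (\<lambda>v :: complex^'n. c *s v)"
  by (rule bounded_linear_intro[where K = "norm c"])
    (simp_all add: vec_eq_iff algebra_simps norm_vector_scalar_mult)

lemma borel_measurable_vector_scalar_mult:
  fixes g :: "'a \<Rightarrow> complex^'n"
  assumes "\<phi> \<in> borel_measurable M" "g \<in> borel_measurable M"
  shows "(\<lambda>x. \<phi> x *s g x) \<in> borel_measurable M"
  using assms by (rule borel_measurable_continuous_Pair)
    (auto simp: vector_scalar_mult_def intro!: continuous_intros)

text \<open>
  Functions of this kind serve as weights for integrands that are controlled only away from the origin.
  The inner radius is normalised to \<open>1\<close>, so that \<open>1 / |x|\<close> and its powers are at most \<open>1\<close> on the support.
\<close>

definition annular_weight :: "real \<Rightarrow> ('a::euclidean_space \<Rightarrow> complex) \<Rightarrow> bool" where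
  "annular_weight B \<phi> \<longleftrightarrow> continuous_on UNIV \<phi> \<and> (\<forall>x. \<phi> x \<noteq> 0 \<longrightarrow> 1 \<le> norm x \<and> norm x \<le> B)"

lemma annular_weight_bounded:
  assumes "annular_weight B (\<phi> :: 'a::euclidean_space \<Rightarrow> complex)"
  obtains L where "L \<ge> 0" "\<And>x. norm (\<phi> x) \<le> L * indicator (cball 0 B) x"
proof -
  have "bounded (\<phi> ` cball 0 B)"
    using assms unfolding annular_weight_def
    by (intro compact_imp_bounded compact_continuous_image) (auto intro: continuous_on_subset)
  then obtain L where "L > 0" "\<And>x. x \<in> cball 0 B \<Longrightarrow> norm (\<phi> x) \<le> L"
    by (auto simp: bounded_pos)
  then show ?thesis
    using assms by (intro that[of L]) (auto simp: annular_weight_def indicator_def)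
qed

lemma annular_weight_measurable:
  "annular_weight B (\<phi> :: 'a::euclidean_space \<Rightarrow> complex) \<Longrightarrow> \<phi> \<in> borel_measurable lebesgue"
  by (auto simp: annular_weight_def intro!: measurable_completion borel_measurable_continuous_onI)

text \<open>
  One dominating function serves all integrands with the same bound outside the unit ball; this is
  what dominated convergence asks for.
\<close>

lemma annular_weight_dominated:
  assumes "annular_weight B (\<phi> :: 'a::euclidean_space \<Rightarrow> complex)"
  obtains w where "integrable lebesgue (w :: 'a \<Rightarrow> real)"
    "\<And>g :: 'a \<Rightarrow> complex^'n. \<And>x. (1 \<le> norm x \<Longrightarrow> norm (g x) \<le> K) \<Longrightarrow> norm (\<phi> x *s g x) \<le> w x"
proof -
  obtain L where L: "L \<ge> 0" "\<And>x. norm (\<phi> x) \<le> L * indicator (cball 0 B) x"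
    using annular_weight_bounded[OF assms] by blast
  have "integrable lebesgue (\<lambda>x::'a. (L * \<bar>K\<bar>) *\<^sub>R indicator (cball 0 B) x :: real)"
    by (rule integrable_bounded_support[where M = "L * \<bar>K\<bar>" and B = B])
       (use L(1) in \<open>auto simp: indicator_def intro!: measurable_completion\<close>)
  moreover have "norm (\<phi> x *s g x) \<le> (L * \<bar>K\<bar>) *\<^sub>R indicator (cball 0 B) x"
    if "1 \<le> norm x \<Longrightarrow> norm (g x) \<le> K" for g :: "'a \<Rightarrow> complex^'n" and x
  proof (cases "\<phi> x = 0")
    case False
    then have "norm (g x) \<le> \<bar>K\<bar>"
      using that assms by (force simp: annular_weight_def)
    then show ?thesis
      using mult_mono[OF L(2)[of x], of "norm (g x)" "\<bar>K\<bar>"] L(1)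
      by (simp add: norm_vector_scalar_mult mult_ac)
  qed (use L in auto)
  ultimately show ?thesis by (rule that)
qed

lemma annular_weight_integrable:
  fixes g :: "'a::euclidean_space \<Rightarrow> complex^'n"
  assumes "annular_weight B \<phi>" "g \<in> borel_measurable lebesgue" "\<And>x. 1 \<le> norm x \<Longrightarrow> norm (g x) \<le> K"
  shows "integrable lebesgue (\<lambda>x. \<phi> x *s g x)"
proof -
  obtain w where w: "integrable lebesgue (w :: 'a \<Rightarrow> real)"
    "\<And>g :: 'a \<Rightarrow> complex^'n. \<And>x. (1 \<le> norm x \<Longrightarrow> norm (g x) \<le> K) \<Longrightarrow> norm (\<phi> x *s g x) \<le> w x"
    using annular_weight_dominated[OF assms(1), where 'n = 'n] by blast
  show ?thesis
  proof (rule Bochner_Integration.integrable_bound[OF w(1)])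
    show "(\<lambda>x. \<phi> x *s g x) \<in> borel_measurable lebesgue"
      using assms(1,2) by (intro borel_measurable_vector_scalar_mult annular_weight_measurable)
    show "AE x in lebesgue. norm (\<phi> x *s g x) \<le> norm (w x)"
      using w(2)[of _ g, OF assms(3)] by (intro AE_I2) (force intro: order_trans[OF _ abs_ge_self])
  qed
qed

lemma annular_weight_integral_tendsto:
  fixes g :: "'a::euclidean_space \<Rightarrow> complex^'n"
  assumes "annular_weight B \<phi>" "\<And>n. G n \<in> borel_measurable lebesgue" "g \<in> borel_measurable lebesgue"
    and "\<And>n x. 1 \<le> norm x \<Longrightarrow> norm (G n x) \<le> K"
    and "\<And>x. 1 \<le> norm x \<Longrightarrow> (\<lambda>n. G n x) \<longlonglongrightarrow> g x"
  shows "(\<lambda>n. LINT x|lebesgue. \<phi> x *s G n x) \<longlonglongrightarrow> (LINT x|lebesgue. \<phi> x *s g x)"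
proof -
  obtain w where w: "integrable lebesgue (w :: 'a \<Rightarrow> real)"
    "\<And>g :: 'a \<Rightarrow> complex^'n. \<And>x. (1 \<le> norm x \<Longrightarrow> norm (g x) \<le> K) \<Longrightarrow> norm (\<phi> x *s g x) \<le> w x"
    using annular_weight_dominated[OF assms(1), where 'n = 'n] by blast
  have "(\<lambda>n. \<phi> x *s G n x) \<longlonglongrightarrow> \<phi> x *s g x" for x
  proof (cases "\<phi> x = 0")
    case False
    then show ?thesis
      using assms(1,5) bounded_linear.tendsto[OF bounded_linear_vector_scalar_mult_right]
      by (force simp: annular_weight_def)
  qed simp
  then show ?thesis
    using assms w
    by (intro integral_dominated_convergence[where w = w])
      (auto intro!: AE_I2 borel_measurable_vector_scalar_mult annular_weight_measurable)
qed

section \<open>The Dirac equation tested at a large scale\<close>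

lemma partial_deriv_scale:
  assumes "\<And>x. \<phi> differentiable at x"
  shows "(\<lambda>x. a * \<phi> (c *\<^sub>R x)) differentiable at x"
    and "partial_deriv j (\<lambda>x. a * \<phi> (c *\<^sub>R x)) = (\<lambda>x. (a * of_real c) * partial_deriv j \<phi> (c *\<^sub>R x))"
proof -
  have D: "((\<lambda>x. a * \<phi> (c *\<^sub>R x)) has_derivative
      (\<lambda>v. a * frechet_derivative \<phi> (at (c *\<^sub>R x)) (c *\<^sub>R v))) (at x)" for x
  proof -
    have "(\<phi> has_derivative frechet_derivative \<phi> (at (c *\<^sub>R x))) (at (c *\<^sub>R x))"
      using assms frechet_derivative_works by blast
    then have "((\<lambda>x. \<phi> (c *\<^sub>R x)) has_derivative (\<lambda>v. frechet_derivative \<phi> (at (c *\<^sub>R x)) (c *\<^sub>R v))) (at x)"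
      by (rule has_derivative_compose[OF bounded_linear_imp_has_derivative[OF bounded_linear_scaleR_right]])
    then show ?thesis
      by (rule has_derivative_mult_right)
  qed
  show "(\<lambda>x. a * \<phi> (c *\<^sub>R x)) differentiable at x"
    using D differentiable_def by blast
  have "frechet_derivative \<phi> (at y) (c *\<^sub>R v) = c *\<^sub>R frechet_derivative \<phi> (at y) v" for y v
    using assms[of y] by (simp add: linear_frechet_derivative linear_scale)
  then show "partial_deriv j (\<lambda>x. a * \<phi> (c *\<^sub>R x)) = (\<lambda>x. (a * of_real c) * partial_deriv j \<phi> (c *\<^sub>R x))"
    by (simp add: partial_deriv_def frechet_derivative_at[OF D, symmetric] fun_eq_iff scaleR_conv_of_real[where 'a = complex])
qed

lemma test_function_differentiable:
  "\<phi> \<in> test_functions \<Longrightarrow> \<phi> differentiable at x"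
  by (force simp: test_functions_def dest: spec[of _ "[]"])

lemma partial_deriv_differentiable:
  "\<phi> \<in> test_functions \<Longrightarrow> partial_deriv j \<phi> differentiable at x"
  by (force simp: test_functions_def dest: spec[of _ "[j]"])

lemma differentiable_imp_lebesgue_measurable:
  fixes g :: "'a::euclidean_space \<Rightarrow> 'b::real_normed_vector"
  assumes "\<And>x. g differentiable at x"
  shows "g \<in> borel_measurable lebesgue"
proof -
  have "continuous_on UNIV g"
    using assms by (simp add: continuous_at_imp_continuous_on differentiable_imp_continuous_within)
  then have "g \<in> borel_measurable borel"
    by (rule borel_measurable_continuous_onI)
  then show ?thesis
    by (simp add: measurable_completion)
qed

lemma test_function_scale:
  assumes "\<phi> \<in> test_functions" and c: "c \<noteq> 0"
  shows "(\<lambda>x. \<phi> (c *\<^sub>R x)) \<in> test_functions"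
proof -
  have d: "foldr partial_deriv js \<phi> differentiable at x" for js x
    using assms(1) by (simp add: test_functions_def)
  have eq: "foldr partial_deriv js (\<lambda>x. \<phi> (c *\<^sub>R x))
      = (\<lambda>x. of_real c ^ length js * foldr partial_deriv js \<phi> (c *\<^sub>R x))" for js
  proof (induction js)
    case (Cons j js)
    then show ?case
      using partial_deriv_scale(2)[OF d, of j "of_real c ^ length js" js c] by (simp add: mult_ac)
  qed simp
  have "bounded {x. \<phi> x \<noteq> 0}"
    using assms(1) by (auto simp: test_functions_def)
  then have "bounded ((*\<^sub>R) (inverse c) ` {x. \<phi> x \<noteq> 0})"
    by (rule bounded_scaling)
  then have "bounded {x. \<phi> (c *\<^sub>R x) \<noteq> 0}"
    by (rule bounded_subset) (use c in \<open>force simp: image_iff\<close>)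
  moreover have "foldr partial_deriv js (\<lambda>x. \<phi> (c *\<^sub>R x)) differentiable at x" for js x
    unfolding eq by (rule partial_deriv_scale(1)[OF d])
  ultimately show ?thesis
    by (simp add: test_functions_def)
qed

text \<open>
  A function that vanishes on an open set has vanishing derivatives there.
\<close>

lemma annular_weight_partial_deriv:
  assumes "\<phi> \<in> test_functions" and "annular_weight B \<phi>"
  shows "annular_weight B (partial_deriv j \<phi>)"
  unfolding annular_weight_def
proof (intro conjI allI impI)
  show "continuous_on UNIV (partial_deriv j \<phi>)"
    using partial_deriv_differentiable[OF assms(1)]
    by (simp add: continuous_at_imp_continuous_on differentiable_imp_continuous_within)
  fix x assume nz: "partial_deriv j \<phi> x \<noteq> 0"
  have outside: "x \<notin> S" if "open S" and S: "\<And>y. y \<in> S \<Longrightarrow> \<phi> y = 0" for S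
  proof
    assume "x \<in> S"
    have "(\<phi> has_derivative (\<lambda>v. 0)) (at x)"
      by (rule has_derivative_transform_within_open[OF has_derivative_const[of 0] \<open>open S\<close> \<open>x \<in> S\<close>])
        (simp add: S)
    then show False
      using nz by (simp add: partial_deriv_def frechet_derivative_at[symmetric])
  qed
  have zero: "\<phi> y = 0" if "y \<in> ball 0 1 \<or> y \<in> - cball 0 B" for y
    using that assms(2) unfolding annular_weight_def by (metis Compl_iff mem_ball_0 mem_cball_0 not_le)
  have "x \<notin> ball 0 1" "x \<notin> - cball 0 B"
    by (rule outside; use zero in \<open>auto simp: open_Compl\<close>)+
  then show "1 \<le> norm x" "norm x \<le> B"
    by simp_all
qed

lemma expansion_rescaled:
  fixes R :: real and c d :: "'b::real_normed_vector"
  assumes "R > 0"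
  shows "R *\<^sub>R (inverse (norm (R *\<^sub>R y)) *\<^sub>R c + inverse ((norm (R *\<^sub>R y))\<^sup>2) *\<^sub>R d)
    = inverse (norm y) *\<^sub>R c + (inverse R * inverse ((norm y)\<^sup>2)) *\<^sub>R d"
proof -
  have "R * inverse (norm (R *\<^sub>R y)) = inverse (norm y)"
    "R * inverse ((norm (R *\<^sub>R y))\<^sup>2) = inverse R * inverse ((norm y)\<^sup>2)"
    using assms by (simp_all add: power2_eq_square)
  then show ?thesis
    by (simp only: scaleR_add_right scaleR_scaleR)
qed

text \<open>
  The equation is tested with \<open>x \<mapsto> \<phi>(x/R)\<close>. Substituting \<open>x = R y\<close> produces a factor \<open>R\<^sup>3\<close>, and
  \<open>R\<^sup>2\<close> where a derivative hits the test function. One power of \<open>R\<close> has been divided out, and the others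
  are distributed over \<open>f\<close> and \<open>A\<close> so that every integrand either has a limit or loses its growing part by parity.
\<close>

lemma dirac_equation_test_scaled:
  assumes A: "\<And>j. (\<lambda>x. A x $ j) \<in> borel_measurable lebesgue"
    and f: "f \<in> borel_measurable lebesgue"
    and eq: "dirac_equation m A lam f"
    and \<phi>: "\<phi> \<in> test_functions" and R: "R > 0"
  shows "(\<Sum>j\<in>UNIV. dirac_alpha j *v
          (\<i> *s (LINT y|lebesgue. partial_deriv j \<phi> y *s (R *\<^sub>R f (R *\<^sub>R y)))
            - (LINT y|lebesgue. \<phi> y *s ((R * A (R *\<^sub>R y) $ j) *\<^sub>R (R *\<^sub>R f (R *\<^sub>R y))))))
      + complex_of_real m *s (dirac_beta *v (LINT y|lebesgue. \<phi> y *s (R\<^sup>2 *\<^sub>R f (R *\<^sub>R y))))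
    = complex_of_real lam *s (LINT y|lebesgue. \<phi> y *s (R\<^sup>2 *\<^sub>R f (R *\<^sub>R y)))"
    (is "(\<Sum>j\<in>UNIV. _ *v (_ *s ?I j - ?J j)) + _ *s (_ *v ?K) = _ *s _")
proof -
  define \<psi> where "\<psi> x = \<phi> (inverse R *\<^sub>R x)" for x
  have \<psi>: "\<psi> \<in> test_functions"
    using test_function_scale[OF \<phi>, of "inverse R"] R by (simp add: \<psi>_def[abs_def])
  have "partial_deriv j \<psi> = (\<lambda>x. of_real (inverse R) * partial_deriv j \<phi> (inverse R *\<^sub>R x))" for j
    using partial_deriv_scale(2)[OF test_function_differentiable[OF \<phi>], of j 1 "inverse R"]
    by (simp add: \<psi>_def[abs_def])
  then have d\<psi>: "partial_deriv j \<psi> (R *\<^sub>R y) = inverse R *\<^sub>R partial_deriv j \<phi> y" for j y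
    using R by (simp add: scaleR_conv_of_real[where 'a = complex])
  have \<psi>': "\<psi> (R *\<^sub>R y) = \<phi> y" for y
    using R by (simp add: \<psi>_def)
  have \<psi>_meas: "\<psi> \<in> borel_measurable lebesgue"
    by (rule differentiable_imp_lebesgue_measurable[OF test_function_differentiable[OF \<psi>]])
  have d\<psi>_meas: "partial_deriv j \<psi> \<in> borel_measurable lebesgue" for j
    by (rule differentiable_imp_lebesgue_measurable[OF partial_deriv_differentiable[OF \<psi>]])
  have substitution: "(LINT x|lebesgue. u x *s g x) = R ^ 3 *\<^sub>R (LINT y|lebesgue. u (R *\<^sub>R y) *s g (R *\<^sub>R y))"
    if "u \<in> borel_measurable lebesgue" "g \<in> borel_measurable lebesgue"
    for u :: "real^3 \<Rightarrow> complex" and g :: "real^3 \<Rightarrow> complex^4"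
    using lebesgue_integral_scaleR[OF borel_measurable_vector_scalar_mult[OF that], of R] R by simp
  have K: "distribution_of f \<psi> = R *\<^sub>R ?K"
    unfolding distribution_of_def substitution[OF \<psi>_meas f]
    using R by (simp add: \<psi>' vector_scalar_mult_scaleR power3_eq_cube power2_eq_square)
  have I: "distribution_of f (partial_deriv j \<psi>) = R *\<^sub>R ?I j" for j
    unfolding distribution_of_def substitution[OF d\<psi>_meas f]
    using R by (simp add: d\<psi> vector_scalar_mult_scaleR power3_eq_cube)
  have J: "distribution_of (\<lambda>x. (A x $ j) *\<^sub>R f x) \<psi> = R *\<^sub>R ?J j" for j
  proof -
    have "\<phi> y *s ((R * A (R *\<^sub>R y) $ j) *\<^sub>R (R *\<^sub>R f (R *\<^sub>R y)))
        = R\<^sup>2 *\<^sub>R (\<phi> y *s (A (R *\<^sub>R y) $ j *\<^sub>R f (R *\<^sub>R y)))" for y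
      by (simp add: vector_scalar_mult_scaleR power2_eq_square mult_ac)
    then have "R *\<^sub>R ?J j = R ^ 3 *\<^sub>R (LINT y|lebesgue. \<phi> y *s (A (R *\<^sub>R y) $ j *\<^sub>R f (R *\<^sub>R y)))"
      by (simp add: power2_eq_square power3_eq_cube)
    moreover have "(\<lambda>x. A x $ j *\<^sub>R f x) \<in> borel_measurable lebesgue"
      using A f by (intro borel_measurable_scaleR)
    ultimately show ?thesis
      unfolding distribution_of_def substitution[OF \<psi>_meas \<open>(\<lambda>x. A x $ j *\<^sub>R f x) \<in> _\<close>] \<psi>' by simp
  qed
  have lin: "M *v (R *\<^sub>R v) = R *\<^sub>R (M *v v)" for M :: "complex^4^4" and v
    by (rule linear_scale[OF bounded_linear.linear[OF matrix_vector_mul_bounded_linear]])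
  have "(1 / \<i>) *s (- (R *\<^sub>R ?I j)) - R *\<^sub>R ?J j = R *\<^sub>R (\<i> *s ?I j - ?J j)" for j
    by (simp add: vec_eq_iff algebra_simps)
  then have "R *\<^sub>R ((\<Sum>j\<in>UNIV. dirac_alpha j *v (\<i> *s ?I j - ?J j)) + complex_of_real m *s (dirac_beta *v ?K))
      = magnetic_dirac m A f \<psi>"
    unfolding magnetic_dirac_def distribution_D_def I J K
    by (simp only: lin vector_scalar_mult_scaleR scaleR_add_right scaleR_sum_right)
  also have "\<dots> = R *\<^sub>R (complex_of_real lam *s ?K)"
    using eq \<psi> K by (simp add: dirac_equation_def vector_scalar_mult_scaleR)
  finally show ?thesis
    using R by simp
qed

text \<open>
  Writing \<open>f = C\<^sub>1/|x| + C\<^sub>2/|x|\<^sup>2 + rem\<close>, everything is controlled by the rescaled remainder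
  \<open>R\<^sup>2 rem(R y)\<close>, which outside the unit ball is bounded and tends to zero. The rescaled potential decays like \<open>R\<close> to the
  power \<open>1 - \<rho>\<close>. The mass and the energy multiply an integral that tends to zero by parity.
\<close>

lemma odd_test_function_limit:
  fixes f :: "real^3 \<Rightarrow> complex^4" and C1 C2 :: "complex^4"
  assumes A: "\<And>j. (\<lambda>x. A x $ j) \<in> borel_measurable lebesgue"
    and decay: "\<And>j x. \<bar>A x $ j\<bar> \<le> C * japanese_bracket x powr (- \<rho>)"
    and \<rho>: "\<rho> > 1" and C: "C > 0"
    and f: "f \<in> borel_measurable lebesgue"
    and eq: "dirac_equation m A lam f"
    and expansion: "(\<lambda>x. norm (f x - (inverse (norm x) *\<^sub>R C1 + inverse ((norm x)\<^sup>2) *\<^sub>R C2)))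
           \<in> o[at_infinity](\<lambda>x. inverse ((norm x)\<^sup>2))"
    and \<phi>: "\<phi> \<in> test_functions" "annular_weight B \<phi>" "\<And>x. \<phi> (- x) = - \<phi> x"
  shows "(\<Sum>j\<in>UNIV. dirac_alpha j *v
      ((LINT y|lebesgue. inverse (norm y) *\<^sub>R partial_deriv j \<phi> y) *s C1)) = 0"
proof -
  define main where "main x = inverse (norm x) *\<^sub>R C1 + inverse ((norm x)\<^sup>2) *\<^sub>R C2" for x :: "real^3"
  define rem where "rem x = f x - main x" for x
  have rem_small: "\<exists>b. \<forall>x. b \<le> norm x \<longrightarrow> norm (rem x) \<le> e * inverse ((norm x)\<^sup>2)" if "e > 0" for e
    using landau_o.smallD[OF expansion that] by (simp add: eventually_at_infinity rem_def main_def)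
  obtain N0 where N0: "\<And>x. N0 \<le> norm x \<Longrightarrow> norm (rem x) \<le> 1 * inverse ((norm x)\<^sup>2)"
    using rem_small[of 1] by auto
  \<comment> \<open>Starting at \<open>N0\<close> puts the points \<open>R y\<close> with \<open>|y| \<ge> 1\<close> where the remainder estimate holds.\<close>
  define R where "R n = max 1 N0 + real n" for n
  have R1: "R n \<ge> 1" and RN: "R n \<ge> N0" and R0: "R n > 0" for n
    by (auto simp: R_def intro: add_increasing2 less_le_trans[OF zero_less_one])
  have Rlim: "filterlim R at_top sequentially"
    unfolding R_def by (intro filterlim_tendsto_add_at_top[OF tendsto_const] filterlim_real_sequentially)
  have Rinv: "(\<lambda>n. inverse (R n)) \<longlonglongrightarrow> 0"
    using Rlim by (rule tendsto_inverse_0_at_top)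
  have norm_ge: "R n \<le> norm (R n *\<^sub>R y)" if "1 \<le> norm y" for n y
    using R0[of n] that by simp

  define E where "E n y = (R n)\<^sup>2 *\<^sub>R rem (R n *\<^sub>R y)" for n y
  define F where "F n y = R n *\<^sub>R f (R n *\<^sub>R y)" for n y
  have main_meas: "main \<in> borel_measurable borel" "(\<lambda>y. inverse (norm y) *\<^sub>R C1) \<in> borel_measurable borel"
    unfolding main_def by measurable
  have scaled_meas: "(\<lambda>y. g (R n *\<^sub>R y)) \<in> borel_measurable lebesgue"
    if "g \<in> borel_measurable lebesgue" for n and g :: "real^3 \<Rightarrow> 'z::topological_space"
    using measurable_compose[OF lebesgue_measurable_scaling that] .
  have rem_meas: "rem \<in> borel_measurable lebesgue"
  proof -
    have "main \<in> borel_measurable lebesgue"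
      by (rule measurable_completion) (simp add: main_meas(1))
    then show ?thesis
      unfolding rem_def[abs_def] by (rule borel_measurable_diff[OF f])
  qed
  have E_meas: "E n \<in> borel_measurable lebesgue" for n
    unfolding E_def[abs_def]
    by (rule borel_measurable_scaleR[OF borel_measurable_const scaled_meas[OF rem_meas]])
  have F_meas: "F n \<in> borel_measurable lebesgue" for n
    unfolding F_def[abs_def]
    by (rule borel_measurable_scaleR[OF borel_measurable_const scaled_meas[OF f]])
  have E_small: "norm (E n y) \<le> e" if "1 \<le> norm y" "norm (rem (R n *\<^sub>R y)) \<le> e * inverse ((norm (R n *\<^sub>R y))\<^sup>2)" "e > 0"
    for n y e
  proof -
    have "norm (E n y) \<le> (R n)\<^sup>2 * (e * inverse ((norm (R n *\<^sub>R y))\<^sup>2))"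
      unfolding E_def using that(2) by (simp add: mult_left_mono)
    also have "\<dots> = e * inverse ((norm y)\<^sup>2)"
      using R0[of n] by (simp add: power_mult_distrib)
    also have "\<dots> \<le> e"
      using that(1,3) by (simp add: inverse_le_1_iff mult_left_le one_le_power)
    finally show ?thesis .
  qed
  have E_bound: "norm (E n y) \<le> 1" if "1 \<le> norm y" for n y
    using E_small[OF that N0] order_trans[OF RN norm_ge[OF that]] by simp
  have E_lim: "(\<lambda>n. E n y) \<longlonglongrightarrow> 0" if y: "1 \<le> norm y" for y
  proof (rule tendstoI)
    fix e :: real assume "e > 0"
    then obtain b where b: "\<And>x. b \<le> norm x \<Longrightarrow> norm (rem x) \<le> (e / 2) * inverse ((norm x)\<^sup>2)"
      using rem_small[of "e / 2"] by auto
    have "\<forall>\<^sub>F n in sequentially. b \<le> R n"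
      using Rlim by (simp add: filterlim_at_top)
    then show "\<forall>\<^sub>F n in sequentially. dist (E n y) 0 < e"
    proof eventually_elim
      case (elim n)
      then have "norm (E n y) \<le> e / 2"
        using E_small[OF y b] norm_ge[OF y, of n] \<open>e > 0\<close> by fastforce
      then show ?case using \<open>e > 0\<close> by simp
    qed
  qed
  have F_eq: "F n y = inverse (norm y) *\<^sub>R C1 + inverse (R n) *\<^sub>R (inverse ((norm y)\<^sup>2) *\<^sub>R C2 + E n y)" for n y
  proof -
    have "F n y = R n *\<^sub>R main (R n *\<^sub>R y) + R n *\<^sub>R rem (R n *\<^sub>R y)"
      by (simp add: F_def rem_def scaleR_add_right[symmetric])
    also have "R n *\<^sub>R rem (R n *\<^sub>R y) = inverse (R n) *\<^sub>R E n y"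
      using R0[of n] by (simp add: E_def power2_eq_square)
    finally show ?thesis
      unfolding main_def expansion_rescaled[OF R0] by (simp add: scaleR_add_right)
  qed
  have inv1: "inverse (norm y) \<le> 1" "inverse ((norm y)\<^sup>2) \<le> 1" if "1 \<le> norm y" for y :: "real^3"
    using that by (simp_all add: inverse_le_1_iff one_le_power)
  have F_bound: "norm (F n y) \<le> norm C1 + (norm C2 + 1)" if y: "1 \<le> norm y" for n y
  proof -
    have "norm (inverse (norm y) *\<^sub>R C1) \<le> norm C1"
      "norm (inverse ((norm y)\<^sup>2) *\<^sub>R C2) \<le> norm C2"
      using inv1[OF y] by (simp_all add: mult_left_le_one_le)
    moreover have "norm (inverse (R n) *\<^sub>R v) \<le> norm v" for v :: "complex^4"
      using R1[of n] by (simp add: mult_left_le_one_le inverse_le_1_iff)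
    ultimately show ?thesis
      unfolding F_eq using E_bound[OF y, of n]
      by (smt (verit, ccfv_SIG) norm_triangle_ineq)
  qed
  have F_lim: "(\<lambda>n. F n y) \<longlonglongrightarrow> inverse (norm y) *\<^sub>R C1" if y: "1 \<le> norm y" for y
  proof -
    have "(\<lambda>n. F n y) \<longlonglongrightarrow> inverse (norm y) *\<^sub>R C1 + 0 *\<^sub>R (inverse ((norm y)\<^sup>2) *\<^sub>R C2 + 0)"
      unfolding F_eq by (intro tendsto_intros Rinv E_lim y)
    then show ?thesis by simp
  qed

  have C1_meas: "(\<lambda>y::real^3. inverse (norm y) *\<^sub>R C1) \<in> borel_measurable lebesgue"
    by (rule measurable_completion) (simp add: main_meas(2))

  define I where "I n j = (LINT y|lebesgue. partial_deriv j \<phi> y *s F n y)" for n j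
  have I_lim: "(\<lambda>n. I n j) \<longlonglongrightarrow> (LINT y|lebesgue. inverse (norm y) *\<^sub>R partial_deriv j \<phi> y) *s C1" for j
  proof -
    note w = annular_weight_partial_deriv[OF \<phi>(1,2), of j]
    obtain L where L: "L \<ge> 0" "\<And>y. norm (partial_deriv j \<phi> y) \<le> L * indicator (cball 0 B) y"
      using annular_weight_bounded[OF w] by blast
    have int: "integrable lebesgue (\<lambda>y. inverse (norm y) *\<^sub>R partial_deriv j \<phi> y)"
    proof (rule integrable_bounded_support[where M = L and B = B])
      have "(\<lambda>y::real^3. inverse (norm y)) \<in> borel_measurable lebesgue"
        by (rule measurable_completion) measurable
      then show "(\<lambda>y. inverse (norm y) *\<^sub>R partial_deriv j \<phi> y) \<in> borel_measurable lebesgue"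
        using annular_weight_measurable[OF w] by (rule borel_measurable_scaleR)
      show "norm (inverse (norm y) *\<^sub>R partial_deriv j \<phi> y) \<le> L" for y
      proof (cases "partial_deriv j \<phi> y = 0")
        case False
        then have "1 \<le> norm y" "norm y \<le> B"
          using w by (auto simp: annular_weight_def)
        then have "norm (partial_deriv j \<phi> y) \<le> L"
          using L(2)[of y] by (simp add: indicator_def)
        moreover have "inverse (norm y) * norm (partial_deriv j \<phi> y) \<le> norm (partial_deriv j \<phi> y)"
          using inv1[OF \<open>1 \<le> norm y\<close>] by (intro mult_left_le_one_le) auto
        ultimately show ?thesis by simp
      qed (use L(1) in simp)
      show "inverse (norm y) *\<^sub>R partial_deriv j \<phi> y = 0" if "norm y > B" for y
        using w that by (force simp: annular_weight_def)
    qed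
    have "(\<lambda>n. I n j) \<longlonglongrightarrow> (LINT y|lebesgue. partial_deriv j \<phi> y *s (inverse (norm y) *\<^sub>R C1))"
      unfolding I_def by (rule annular_weight_integral_tendsto[OF w F_meas C1_meas F_bound F_lim])
    also have "(LINT y|lebesgue. partial_deriv j \<phi> y *s (inverse (norm y) *\<^sub>R C1))
        = (LINT y|lebesgue. (inverse (norm y) *\<^sub>R partial_deriv j \<phi> y) *s C1)"
      by (simp add: vector_scalar_mult_scaleR)
    also have "\<dots> = (LINT y|lebesgue. inverse (norm y) *\<^sub>R partial_deriv j \<phi> y) *s C1"
      by (rule integral_bounded_linear[OF bounded_linear_vector_scalar_mult_left int])
    finally show ?thesis .
  qed

  define J where "J n j = (LINT y|lebesgue. \<phi> y *s ((R n * A (R n *\<^sub>R y) $ j) *\<^sub>R F n y))" for n j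
  have J_lim: "(\<lambda>n. J n j) \<longlonglongrightarrow> 0" for j
  proof -
    have A_bound: "\<bar>R n * A (R n *\<^sub>R y) $ j\<bar> \<le> C * R n powr (1 - \<rho>)" if y: "1 \<le> norm y" for n y
    proof -
      have "R n \<le> japanese_bracket (R n *\<^sub>R y)"
        using norm_ge[OF y, of n] unfolding japanese_bracket_def
        by (intro order_trans[OF _ real_le_rsqrt[OF order_refl]] order_trans[OF _ real_sqrt_le_mono[of "(norm (R n *\<^sub>R y))\<^sup>2"]]) auto
      then have "japanese_bracket (R n *\<^sub>R y) powr (- \<rho>) \<le> R n powr (- \<rho>)"
        using R0[of n] \<rho> by (intro powr_mono2') auto
      then have "\<bar>A (R n *\<^sub>R y) $ j\<bar> \<le> C * R n powr (- \<rho>)"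
        using decay[of "R n *\<^sub>R y" j] C by (meson mult_left_mono order_trans less_imp_le)
      then have "R n * \<bar>A (R n *\<^sub>R y) $ j\<bar> \<le> R n * (C * R n powr (- \<rho>))"
        using R0[of n] by (intro mult_left_mono) auto
      also have "\<dots> = C * R n powr (1 - \<rho>)"
        using R0[of n] by (simp add: powr_diff powr_minus_divide)
      finally show ?thesis
        using R0[of n] by (simp add: abs_mult)
    qed
    have R_powr: "R n powr (1 - \<rho>) \<le> 1" for n
      using powr_mono[of "1 - \<rho>" 0 "R n"] R1[of n] R0[of n] \<rho> by simp
    have powr_lim: "(\<lambda>n. R n powr (1 - \<rho>)) \<longlonglongrightarrow> 0"
      using \<rho> by (intro tendsto_neg_powr Rlim) auto
    have "(\<lambda>n. J n j) \<longlonglongrightarrow> (LINT y|lebesgue. \<phi> y *s (0::complex^4))"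
      unfolding J_def
    proof (rule annular_weight_integral_tendsto[OF \<phi>(2)])
      show "(\<lambda>y. (R n * A (R n *\<^sub>R y) $ j) *\<^sub>R F n y) \<in> borel_measurable lebesgue" for n
        by (intro borel_measurable_scaleR[OF borel_measurable_times[OF borel_measurable_const scaled_meas[OF A]] F_meas])
      show "norm ((R n * A (R n *\<^sub>R y) $ j) *\<^sub>R F n y) \<le> C * (norm C1 + (norm C2 + 1))"
        if y: "1 \<le> norm y" for n y
      proof -
        have "\<bar>R n * A (R n *\<^sub>R y) $ j\<bar> \<le> C"
          using A_bound[OF y, of n] R_powr[of n] C by (smt (verit) mult_left_le)
        then show ?thesis
          using F_bound[OF y, of n] C unfolding norm_scaleR by (intro mult_mono) auto
      qed
      show "(\<lambda>n. (R n * A (R n *\<^sub>R y) $ j) *\<^sub>R F n y) \<longlonglongrightarrow> 0" if y: "1 \<le> norm y" for y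
      proof -
        have "(\<lambda>n. R n * A (R n *\<^sub>R y) $ j) \<longlonglongrightarrow> 0"
        proof (rule Lim_null_comparison)
          show "\<forall>\<^sub>F n in sequentially. norm (R n * A (R n *\<^sub>R y) $ j) \<le> C * R n powr (1 - \<rho>)"
            using A_bound[OF y] by simp
          show "(\<lambda>n. C * R n powr (1 - \<rho>)) \<longlonglongrightarrow> 0"
            using tendsto_mult[OF tendsto_const powr_lim, of C] by simp
        qed
        then show ?thesis
          using tendsto_scaleR[OF _ F_lim[OF y]] by fastforce
      qed
    qed simp
    then show ?thesis by simp
  qed

  define K where "K n = (LINT y|lebesgue. \<phi> y *s ((R n)\<^sup>2 *\<^sub>R f (R n *\<^sub>R y)))" for n
  have K_lim: "K \<longlonglongrightarrow> 0"
  proof -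
    \<comment> \<open>The even part, which would diverge if it did not cancel.\<close>
    define P where "P n y = R n *\<^sub>R (inverse (norm y) *\<^sub>R C1) + inverse ((norm y)\<^sup>2) *\<^sub>R C2" for n and y :: "real^3"
    have P_meas: "P n \<in> borel_measurable lebesgue" for n
      unfolding P_def[abs_def] by (rule measurable_completion) measurable
    have P_bound: "norm (P n y) \<le> R n * norm C1 + norm C2" if "1 \<le> norm y" for n y
    proof -
      have "norm (R n *\<^sub>R (inverse (norm y) *\<^sub>R C1)) \<le> R n * norm C1"
        "norm (inverse ((norm y)\<^sup>2) *\<^sub>R C2) \<le> norm C2"
        using inv1[OF that] R0[of n] by (simp_all add: mult_left_le_one_le)
      then show ?thesis
        unfolding P_def by (smt (verit) norm_triangle_ineq)
    qed
    have split: "(R n)\<^sup>2 *\<^sub>R f (R n *\<^sub>R y) = P n y + E n y" for n y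
    proof -
      have "(R n)\<^sup>2 *\<^sub>R f (R n *\<^sub>R y) = R n *\<^sub>R F n y"
        by (simp add: F_def power2_eq_square)
      then show ?thesis
        unfolding F_eq P_def using R0[of n] by (simp add: scaleR_add_right)
    qed
    have "(LINT y|lebesgue. \<phi> y *s P n y) = 0" for n
    proof (rule lebesgue_integral_odd)
      show "(\<lambda>y. \<phi> y *s P n y) \<in> borel_measurable lebesgue"
        by (rule borel_measurable_vector_scalar_mult[OF annular_weight_measurable[OF \<phi>(2)] P_meas])
      show "\<phi> (- y) *s P n (- y) = - (\<phi> y *s P n y)" for y
        by (simp add: \<phi>(3) P_def vec_eq_iff)
    qed
    then have K_eq: "K n = (LINT y|lebesgue. \<phi> y *s E n y)" for n
      unfolding K_def split vector_add_ldistrib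
      using annular_weight_integrable[OF \<phi>(2) P_meas P_bound] annular_weight_integrable[OF \<phi>(2) E_meas E_bound]
      by simp
    have "(\<lambda>n. LINT y|lebesgue. \<phi> y *s E n y) \<longlonglongrightarrow> (LINT y|lebesgue. \<phi> y *s 0)"
      by (rule annular_weight_integral_tendsto[OF \<phi>(2) E_meas _ E_bound E_lim]) auto
    moreover have "K = (\<lambda>n. LINT y|lebesgue. \<phi> y *s E n y)"
      using K_eq by (rule ext)
    ultimately show ?thesis
      by simp
  qed

  have mv: "(\<lambda>n. M *v X n) \<longlonglongrightarrow> M *v X'" if "X \<longlonglongrightarrow> X'" for M :: "complex^4^4" and X X'
    by (rule bounded_linear.tendsto[OF matrix_vector_mul_bounded_linear that])
  have sv: "(\<lambda>n. c *s X n) \<longlonglongrightarrow> c *s X'" if "X \<longlonglongrightarrow> X'" for c and X :: "nat \<Rightarrow> complex^4" and X'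
    by (rule bounded_linear.tendsto[OF bounded_linear_vector_scalar_mult_right that])
  let ?w = "\<lambda>j. LINT y|lebesgue. inverse (norm y) *\<^sub>R partial_deriv j \<phi> y"
  have "(\<lambda>n. (\<Sum>j\<in>UNIV. dirac_alpha j *v (\<i> *s I n j - J n j)) + complex_of_real m *s (dirac_beta *v K n)
        - complex_of_real lam *s K n)
      \<longlonglongrightarrow> (\<Sum>j\<in>UNIV. dirac_alpha j *v (\<i> *s (?w j *s C1) - 0)) + complex_of_real m *s (dirac_beta *v 0)
        - complex_of_real lam *s 0"
    by (intro tendsto_intros mv sv I_lim J_lim K_lim)
  moreover have "(\<Sum>j\<in>UNIV. dirac_alpha j *v (\<i> *s I n j - J n j)) + complex_of_real m *s (dirac_beta *v K n)
        = complex_of_real lam *s K n" for n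
    using dirac_equation_test_scaled[OF A f eq \<phi>(1) R0[of n]] unfolding I_def J_def K_def F_def .
  ultimately have "(\<Sum>j\<in>UNIV. dirac_alpha j *v (\<i> *s (?w j *s C1))) = 0"
    by (simp add: LIMSEQ_const_iff)
  then have "\<i> *s (\<Sum>j\<in>UNIV. dirac_alpha j *v (?w j *s C1)) = 0"
    by (simp add: vec.scale_sum_right vector_scalar_commute)
  then show ?thesis
    by (simp add: vec_eq_iff)
qed

section \<open>An odd test function and the Clifford relations\<close>

lemma dirac_alpha_mult:
  fixes v :: "complex^4"
  shows "dirac_alpha 1 *v v = vector [v $ 4, v $ 3, v $ 2, v $ 1]"
    and "dirac_alpha 2 *v v = vector [- \<i> * v $ 4, \<i> * v $ 3, - \<i> * v $ 2, \<i> * v $ 1]"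
    and "dirac_alpha 3 *v v = vector [v $ 3, - v $ 4, v $ 1, - v $ 2]"
  by (simp_all add: dirac_alpha_def block_matrix_def pauli_def vec_eq_iff forall_4 sum_4
      matrix_vector_mult_def vector_def)

text \<open>
  The matrix \<open>\<alpha> \<cdot> w\<close> squares to \<open>|w|\<^sup>2\<close>. It exchanges the upper and the lower pair of components, so each
  pair satisfies the same two linear equations, with coefficient matrix \<open>\<sigma> \<cdot> w\<close>.
\<close>

lemma dirac_alpha_kernel_trivial:
  fixes v :: "complex^4" and w :: "3 \<Rightarrow> real"
  assumes "(\<Sum>j\<in>UNIV. dirac_alpha j *v (complex_of_real (w j) *s v)) = 0" and "w j \<noteq> 0"
  shows "v = 0"
proof -
  have cancel: "a = 0 \<and> b = 0"
    if 1: "w 1 * b - \<i> * w 2 * b + w 3 * a = 0" and 2: "w 1 * a + \<i> * w 2 * a - w 3 * b = 0" for a b :: complex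
  proof -
    \<comment> \<open>The coefficients are the rows of \<open>\<sigma> \<cdot> w\<close>, applied a second time.\<close>
    have "complex_of_real ((w 1)\<^sup>2 + (w 2)\<^sup>2 + (w 3)\<^sup>2) * a
        = w 3 * (w 1 * b - \<i> * w 2 * b + w 3 * a) + (w 1 - \<i> * w 2) * (w 1 * a + \<i> * w 2 * a - w 3 * b)"
      by (simp add: algebra_simps power2_eq_square)
    moreover have "complex_of_real ((w 1)\<^sup>2 + (w 2)\<^sup>2 + (w 3)\<^sup>2) * b
        = (w 1 + \<i> * w 2) * (w 1 * b - \<i> * w 2 * b + w 3 * a) - w 3 * (w 1 * a + \<i> * w 2 * a - w 3 * b)"
      by (simp add: algebra_simps power2_eq_square)
    moreover have "(w 1)\<^sup>2 + (w 2)\<^sup>2 + (w 3)\<^sup>2 \<noteq> 0"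
      using assms(2) exhaust_3[of j] by (auto simp: add_nonneg_eq_0_iff)
    ultimately show ?thesis
      unfolding 1 2 by (simp del: of_real_add of_real_power)
  qed
  have "v $ 3 = 0 \<and> v $ 4 = 0" "v $ 1 = 0 \<and> v $ 2 = 0"
    using assms(1) by (intro cancel; simp add: sum_3 dirac_alpha_mult vec_eq_iff forall_4 vector_def algebra_simps)+
  then show ?thesis
    by (simp add: vec_eq_iff forall_4)
qed

definition odd_test :: "real^3 \<Rightarrow> real" where
  "odd_test = tensor3 bump bump odd_bump"

lemma odd_test_odd: "odd_test (- x) = - odd_test x"
  by (simp add: odd_test_def tensor3_def bump_even odd_bump_odd)

lemma odd_test_support:
  assumes "odd_test x \<noteq> 0"
  shows "1 \<le> norm x" "norm x \<le> 5"
proof -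
  have nz: "bump (x $ 1) \<noteq> 0" "bump (x $ 2) \<noteq> 0" "odd_bump (x $ 3) \<noteq> 0"
    using assms by (auto simp: odd_test_def tensor3_def)
  then have b: "\<bar>x $ 1\<bar> < 1" "\<bar>x $ 2\<bar> < 1" "1 < \<bar>x $ 3\<bar>" "\<bar>x $ 3\<bar> < 3"
    using bump_eq_0 odd_bump_eq_0 by (meson not_le)+
  show "1 \<le> norm x"
    using b(3) component_le_norm_cart[of x 3] by linarith
  show "norm x \<le> 5"
    using b norm_le_l1_cart[of x] by (simp add: sum_3)
qed

lemma odd_test_times_nonneg: "odd_test x * x $ 3 \<ge> 0"
  using odd_bump_times_nonneg[of "x $ 3"] bump_nonneg
  by (simp add: odd_test_def tensor3_def mult.assoc)

lemma odd_test_test_function: "(\<lambda>x. complex_of_real (odd_test x)) \<in> test_functions"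
proof -
  have "bounded {x. odd_test x \<noteq> 0}"
    using odd_test_support(2) by (auto simp: bounded_iff)
  then show ?thesis
    unfolding odd_test_def
    by (intro tensor3_test_function bump_in_flat_algebra odd_bump_in_flat_algebra)
qed

lemma odd_test_annular_weight: "annular_weight 5 (\<lambda>x. complex_of_real (odd_test x))"
proof -
  have "continuous_on UNIV (\<lambda>x. complex_of_real (odd_test x))"
    by (intro continuous_at_imp_continuous_on ballI differentiable_imp_continuous_within
        test_function_differentiable odd_test_test_function)
  then show ?thesis
    using odd_test_support by (auto simp: annular_weight_def)
qed

lemma has_derivative_inverse_norm:
  fixes x :: "'a::real_inner"
  assumes "x \<noteq> 0"
  shows "((\<lambda>y. inverse (norm y)) has_derivative (\<lambda>v. - (v \<bullet> x) * inverse (norm x ^ 3))) (at x)"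
proof -
  have "((\<lambda>y. inverse (norm y)) has_derivative (\<lambda>v. - (inverse (norm x) * (v \<bullet> sgn x) * inverse (norm x)))) (at x)"
    using assms by (intro Deriv.has_derivative_inverse has_derivative_norm) auto
  then show ?thesis
    by (simp add: sgn_div_norm power3_eq_cube mult_ac)
qed

text \<open>
  The vector field \<open>\<phi>(y)/|y|\<close> times the third unit vector has compact support, so its divergence
  \<open>\<partial>\<^sub>3\<phi>/|y| - \<phi> y\<^sub>3/|y|\<^sup>3\<close> integrates to zero. The second term is of one sign and nonzero on
  a nonempty open set. The weights are real because \<open>\<phi>\<close> is.
\<close>

lemma odd_test_weight_nonzero:
  obtains w :: "3 \<Rightarrow> real" where "w 3 \<noteq> 0"
    "\<And>j. (LINT y|lebesgue. inverse (norm y) *\<^sub>R partial_deriv j (\<lambda>x. complex_of_real (odd_test x)) y)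
      = complex_of_real (w j)"
proof -
  let ?\<phi> = "\<lambda>x. complex_of_real (odd_test x)"
  obtain b' where b': "\<And>t. (bump has_real_derivative b' t) (at t)"
    using flat_algebra_DERIV[OF bump_in_flat_algebra] by blast
  obtain r' where r': "\<And>t. (odd_bump has_real_derivative r' t) (at t)"
    using flat_algebra_DERIV[OF odd_bump_in_flat_algebra] by blast
  define P' where "P' x v = tensor3 b' bump odd_bump x * v $ 1 + tensor3 bump b' odd_bump x * v $ 2
      + tensor3 bump bump r' x * v $ 3" for x v :: "real^3"
  have P': "(odd_test has_derivative P' x) (at x)" for x
    unfolding odd_test_def P'_def by (rule has_derivative_tensor3[OF b' b' r'])
  have \<phi>': "partial_deriv j ?\<phi> x = complex_of_real (P' x (axis j 1))" for j x
    by (rule partial_deriv_of_real(2)[OF P'])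
  define w where "w j = (LINT y|lebesgue. inverse (norm y) * P' y (axis j 1))" for j
  have w: "(LINT y|lebesgue. inverse (norm y) *\<^sub>R partial_deriv j ?\<phi> y) = complex_of_real (w j)" for j
    unfolding \<phi>' w_def integral_complex_of_real[symmetric] by (simp add: scaleR_conv_of_real)

  let ?e = "axis 3 1 :: real^3"
  define Q where "Q y = odd_test y * y $ 3 * inverse (norm y ^ 3)" for y
  define F' where "F' x v = inverse (norm x) * P' x v - odd_test x * ((v \<bullet> x) * inverse (norm x ^ 3))" for x v
  have F': "((\<lambda>x. inverse (norm x) * odd_test x) has_derivative F' x) (at x)" for x
  proof (cases "x = 0")
    case False
    show ?thesis
      using has_derivative_mult[OF has_derivative_inverse_norm[OF False] P']
      by (simp add: F'_def[abs_def] algebra_simps)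
  next
    case True
    have "((\<lambda>x. inverse (norm x) * odd_test x) has_derivative (\<lambda>v. 0)) (at 0)"
    proof (rule has_derivative_transform_within_open[OF has_derivative_const[of 0] open_ball])
      show "(0::real^3) \<in> ball 0 1" by simp
      show "0 = inverse (norm y) * odd_test y" if "y \<in> ball 0 1" for y
        using odd_test_support(1)[of y] that by auto
    qed
    \<comment> \<open>The formula for \<open>F'\<close> also gives zero at the origin, because \<open>inverse 0 = 0\<close>.\<close>
    then show ?thesis
      by (simp add: True F'_def[abs_def])
  qed
  have F'_e: "F' y ?e = inverse (norm y) * P' y ?e - Q y" for y
    by (simp add: F'_def Q_def inner_axis' mult_ac)
  have inv_le: "inverse (norm y ^ k) \<le> 1" if "1 \<le> norm y" for y :: "real^3" and k
    using that by (simp add: inverse_le_1_iff one_le_power)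

  obtain L where L: "\<And>y. norm (?\<phi> y) \<le> L * indicator (cball 0 5) y" and "L \<ge> 0"
    using annular_weight_bounded[OF odd_test_annular_weight] by blast
  have weight': "annular_weight 5 (partial_deriv 3 ?\<phi>)"
    by (rule annular_weight_partial_deriv[OF odd_test_test_function odd_test_annular_weight])
  obtain L' where L': "\<And>y. norm (partial_deriv 3 ?\<phi> y) \<le> L' * indicator (cball 0 5) y" and "L' \<ge> 0"
    using annular_weight_bounded[OF weight'] by blast
  have Q_bound: "\<bar>Q y\<bar> \<le> L * 5" for y
  proof (cases "odd_test y = 0")
    case False
    note n = odd_test_support[OF False]
    have "\<bar>odd_test y\<bar> \<le> L" "\<bar>y $ 3\<bar> \<le> 5"
      using L[of y] n component_le_norm_cart[of y 3] by auto
    then have "\<bar>odd_test y\<bar> * \<bar>y $ 3\<bar> \<le> L * 5"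
      using \<open>L \<ge> 0\<close> by (intro mult_mono) auto
    moreover have "\<bar>Q y\<bar> \<le> \<bar>odd_test y\<bar> * \<bar>y $ 3\<bar>"
      using inv_le[OF n(1), of 3] unfolding Q_def abs_mult by (intro mult_left_le) auto
    ultimately show ?thesis by linarith
  qed (use \<open>L \<ge> 0\<close> in \<open>simp add: Q_def\<close>)
  have Q_supp: "Q y = 0" if "norm y > 5" for y
    using odd_test_support(2)[of y] that by (auto simp: Q_def)
  have P'_nz: "1 \<le> norm y \<and> norm y \<le> 5" if "P' y ?e \<noteq> 0" for y
    using weight' that by (auto simp: annular_weight_def \<phi>')
  have G_bound: "\<bar>inverse (norm y) * P' y ?e\<bar> \<le> L'" for y
  proof (cases "P' y ?e = 0")
    case False
    note n = P'_nz[OF False]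
    then have "\<bar>P' y ?e\<bar> \<le> L'"
      using L'[of y] by (simp add: \<phi>')
    moreover have "inverse (norm y) * \<bar>P' y ?e\<bar> \<le> \<bar>P' y ?e\<bar>"
      using n inv_le[of y 1] by (intro mult_left_le_one_le) auto
    ultimately show ?thesis by (simp add: abs_mult)
  qed (use \<open>L' \<ge> 0\<close> in simp)
  have cont: "continuous_on UNIV odd_test"
    using P' by (auto intro!: continuous_at_imp_continuous_on has_derivative_continuous)
  have "odd_test \<in> borel_measurable borel"
    by (rule borel_measurable_continuous_onI[OF cont])
  then have Q_int: "integrable lebesgue Q"
    using Q_bound Q_supp
    by (intro integrable_bounded_support[where M = "L * 5" and B = 5])
       (auto simp: Q_def[abs_def] intro!: measurable_completion)
  have "(\<lambda>y. P' y ?e) \<in> borel_measurable borel"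
  proof (rule borel_measurable_continuous_onI)
    have "continuous_on UNIV (\<lambda>y. Re (partial_deriv 3 ?\<phi> y))"
      using weight' by (intro continuous_on_Re) (simp add: annular_weight_def)
    then show "continuous_on UNIV (\<lambda>y. P' y ?e)"
      by (simp add: \<phi>')
  qed
  then have G_int: "integrable lebesgue (\<lambda>y. inverse (norm y) * P' y ?e)"
    using G_bound P'_nz
    by (intro integrable_bounded_support[where M = L' and B = 5])
       (auto intro!: measurable_completion simp: not_le[symmetric])
  have "(LINT y|lebesgue. F' y ?e) = 0"
  proof (rule integral_directional_derivative_eq_0[OF F'])
    show "\<bar>F' y ?e\<bar> \<le> L' + L * 5" for y
      unfolding F'_e using G_bound[of y] Q_bound[of y] by linarith
    show "inverse (norm y) * odd_test y = 0" if "norm y > 5" for y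
      using odd_test_support(2)[of y] that by auto
  qed
  then have w3: "w 3 = (LINT y|lebesgue. Q y)"
    using G_int Q_int by (simp add: F'_e w_def)
  have "w 3 \<noteq> 0"
  proof
    have open_nz: "open {y. odd_test y \<noteq> 0}"
      using cont by (intro open_Collect_neq) auto
    assume "w 3 = 0"
    moreover have "0 \<le> Q y" for y
      using odd_test_times_nonneg[of y] by (simp add: Q_def)
    ultimately have "AE y in lebesgue. Q y = 0"
      using integral_nonneg_eq_0_iff_AE[OF Q_int] w3 by simp
    moreover have "Q y \<noteq> 0" if "odd_test y \<noteq> 0" for y
    proof -
      have "y $ 3 \<noteq> 0"
        using that odd_bump_eq_0[of "y $ 3"] by (auto simp: odd_test_def tensor3_def)
      then show ?thesis
        using that odd_test_support(1)[OF that] by (auto simp: Q_def)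
    qed
    ultimately have "AE y in lebesgue. odd_test y = 0"
      by (auto elim: eventually_mono)
    then have "{y. odd_test y \<noteq> 0} \<in> null_sets lebesgue"
      using borel_open[OF open_nz] by (subst AE_iff_null_sets) auto
    then have "negligible {y. odd_test y \<noteq> 0}"
      by (simp add: negligible_iff_null_sets)
    moreover have "odd_test (2 *\<^sub>R ?e) \<noteq> 0"
      using bump_pos_iff[of 0] bump_eq_0[of 4] by (simp add: odd_test_def tensor3_def odd_bump_def axis_def)
    ultimately show False
      using open_nz open_not_negligible by blast
  qed
  then show ?thesis
    using w that by blast
qed

theorem theorem6p2:
  fixes m \<rho> C :: real
    and A :: "real^3 \<Rightarrow> real^3"
    and f :: "real^3 \<Rightarrow> complex^4"
    and C1 C2 :: "complex^4"
  assumes "m > 0"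
    and "\<And>j. (\<lambda>x. A x $ j) \<in> borel_measurable lebesgue"
    and "\<rho> > 3 / 2" and "C > 0"
    and "\<And>j x. \<bar>A x $ j\<bar> \<le> C * japanese_bracket x powr (- \<rho>)"
    and "f \<in> L2_loc"
    and "dirac_equation m A m f \<or> dirac_equation m A (- m) f"
    and "(\<lambda>x. norm (f x - (inverse (norm x) *\<^sub>R C1 + inverse ((norm x)\<^sup>2) *\<^sub>R C2)))
           \<in> o[at_infinity](\<lambda>x. inverse ((norm x)\<^sup>2))"
  shows "C1 = 0"
proof -
  obtain lam where lam: "dirac_equation m A lam f"
    using assms(7) by blast
  have f: "f \<in> borel_measurable lebesgue"
    using assms(6) by (simp add: L2_loc_def)
  obtain w :: "3 \<Rightarrow> real" where w: "w 3 \<noteq> 0"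
    "\<And>j. (LINT y|lebesgue. inverse (norm y) *\<^sub>R partial_deriv j (\<lambda>x. complex_of_real (odd_test x)) y)
      = complex_of_real (w j)"
    using odd_test_weight_nonzero by blast
  have "(\<Sum>j\<in>UNIV. dirac_alpha j *v (complex_of_real (w j) *s C1)) = 0"
    using odd_test_function_limit[OF assms(2,5) _ assms(4) f lam assms(8)
        odd_test_test_function odd_test_annular_weight] assms(3)
    unfolding w(2) by (simp add: odd_test_odd)
  then show ?thesis
    using w(1) by (rule dirac_alpha_kernel_trivial)
qed

end
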